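(* Let $m\ge1$ and $\theta>1$. For $f\in W^{1,\infty}_{\mathrm{loc}}(\mathbb{R}^m)$ bounded from below, let $\lambda^*(f)$ be the critical value defined in the context. Then: (i) For every $f\in W^{1,\infty}_{\mathrm{loc}}(\mathbb{R}^m)$ bounded from below and every $c\in\mathbb{R}$, $\lambda^*(f+c)=\lambda^*(f)+c$. (ii) If $f_1,f_2\in W^{1,\infty}_{\mathrm{loc}}(\mathbb{R}^m)$ are bounded from below and $f_1\le f_2$ in $\mathbb{R}^m$, then $\lambda^*(f_1)\le\lambda^*(f_2)$. (iii) For all $f_1,f_2\in W^{1,\infty}_{\mathrm{loc}}(\mathbb{R}^m)$ bounded from below and all $0\le t\le1$, $$\lambda^*(tf_1+(1-t)f_2)\ge t\lambda^*(f_1)+(1-t)\lambda^*(f_2).$$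
   Context: For $f\in W^{1,\infty}_{\mathrm{loc}}(\mathbb{R}^m)$ (i.e. locally Lipschitz continuous) bounded from below, $\lambda^*(f)$ is the supremum of all $\lambda\in\mathbb{R}$ for which there exists $\phi\in C^2(\mathbb{R}^m)$ with $-\frac12\Delta\phi(y)+\frac1\theta|D\phi(y)|^\theta\le f(y)-\lambda$ for all $y\in\mathbb{R}^m$ (this supremum is a finite real number). *)

theory Defs
  imports "HOL-Analysis.Analysis"
begin

definition locally_lipschitz :: "(real^'m \<Rightarrow> real) \<Rightarrow> bool" where
  "locally_lipschitz f \<longleftrightarrow> (\<forall>x. \<exists>r>0. \<exists>L. L-lipschitz_on (cball x r) f)"

definition partial :: "'m \<Rightarrow> (real^'m \<Rightarrow> real) \<Rightarrow> real^'m \<Rightarrow> real" where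
  "partial i \<phi> x = deriv (\<lambda>s. \<phi> (x + s *\<^sub>R axis i 1)) 0"

(* deriv is total with an unspecified value where no derivative exists, so
   continuity of the partial derivatives alone would not express C^1;
   differentiability has to be required separately. *)
definition C1 :: "(real^'m \<Rightarrow> real) \<Rightarrow> bool" where
  "C1 \<phi> \<longleftrightarrow> \<phi> differentiable_on UNIV \<and> (\<forall>i. continuous_on UNIV (partial i \<phi>))"

definition C2 :: "(real^'m \<Rightarrow> real) \<Rightarrow> bool" where
  "C2 \<phi> \<longleftrightarrow> C1 \<phi> \<and> (\<forall>i. C1 (partial i \<phi>))"

definition grad :: "(real^'m \<Rightarrow> real) \<Rightarrow> real^'m \<Rightarrow> real^'m" where
  "grad \<phi> x = (\<chi> i. partial i \<phi> x)"

definition laplacian :: "(real^'m \<Rightarrow> real) \<Rightarrow> real^'m \<Rightarrow> real" where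
  "laplacian \<phi> x = (\<Sum>i\<in>UNIV. partial i (partial i \<phi>) x)"

(* Sup is the supremum in the reals. It is meaningful when the set is nonempty and
   bounded above, which holds for 1 < \<theta> and f locally Lipschitz and bounded below. *)
definition critical_value :: "real \<Rightarrow> (real^'m \<Rightarrow> real) \<Rightarrow> real" where
  "critical_value \<theta> f = Sup {l. \<exists>\<phi>. C2 \<phi> \<and>
     (\<forall>y. - (1/2) * laplacian \<phi> y + (1/\<theta>) * norm (grad \<phi> y) powr \<theta> \<le> f y - l)}"

end

theory Submission
  imports Defs
begin

text \<open>
  The critical value is the supremum, in the reals, of the set of those \<open>l\<close> for which a
  subsolution \<open>\<phi>\<close> exists. Each of the three claims is immediate for these sets: adding
  \<open>c\<close> to \<open>f\<close> translates the set, a larger \<open>f\<close> has a larger set, and a convex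
  combination of subsolutions is again a subsolution because the Laplacian is linear and
  \<open>p \<mapsto> \<bar>p\<bar>\<^sup>\<theta>\<close> is convex. What remains, and is the real content, is that the suprema
  are those of nonempty sets bounded above. Constants are subsolutions for \<open>l \<le> inf f\<close>. The
  upper bound, lemma \<open>admissible_bdd_above\<close>, comes from comparison with a function that blows up on the boundary of a cube.

  Suppose \<open>w\<close> is smooth on the open cube, tends to infinity at its boundary, and satisfies
  \<open>\<Delta>w / 2 - \<bar>Dw\<bar>\<^sup>\<theta> / \<theta> \<le> A\<close>. For a subsolution \<open>\<phi>\<close> with constant \<open>l\<close> the
  difference \<open>\<phi> - w\<close> has a maximum inside the cube; there \<open>D\<phi> = Dw\<close> and
  \<open>\<Delta>\<phi> \<le> \<Delta>w\<close>, hence \<open>l \<le> f + A\<close> at that point, and so \<open>l \<le> max f + A\<close>, the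
  maximum being taken over the closed cube. This does not depend on \<open>\<phi>\<close>.

  Taking \<open>w(x) = \<Sum>i. g(x\<^sub>i)\<close> with \<open>g(s) = (1 - s\<^sup>2)\<^sup>-\<^sup>n\<close> reduces everything to
  functions of one variable, since the pure partial derivatives are all that occurs
  (\<open>C2_touched_by_barrier\<close>). Near
  \<open>s = \<plusminus>1\<close> the second derivative of \<open>g\<close> has order \<open>n + 2\<close> in \<open>1 / (1 - s\<^sup>2)\<close> while
  \<open>\<bar>g'\<bar>\<^sup>\<theta>\<close> has order \<open>(n + 1) \<theta>\<close>; as \<open>\<theta> > 1\<close>, the latter wins once \<open>n\<close> is large
  (\<open>barrier_supersolution\<close>).
\<close>

section \<open>Partial derivatives\<close>

lemma C1_has_partial:
  assumes "C1 \<phi>"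
  shows "((\<lambda>s. \<phi> (x + s *\<^sub>R axis i 1)) has_real_derivative partial i \<phi> (x + s *\<^sub>R axis i 1)) (at s)"
proof -
  have d: "\<phi> differentiable at z" for z
    using assms by (simp add: C1_def differentiable_on_def)
  have line: "(\<lambda>s. \<phi> (z + s *\<^sub>R axis i 1)) differentiable at (0::real)" for z
    by (rule differentiable_chain_at[unfolded o_def, where f="\<lambda>s. z + s *\<^sub>R axis i 1" and g=\<phi>])
       (auto intro!: derivative_intros d)
  have "((\<lambda>h. \<phi> ((x + s *\<^sub>R axis i 1) + h *\<^sub>R axis i 1)) has_real_derivative
      partial i \<phi> (x + s *\<^sub>R axis i 1)) (at 0)"
    unfolding partial_def using line DERIV_deriv_iff_real_differentiable by blast
  then have "((\<lambda>h. \<phi> (x + (h + s) *\<^sub>R axis i 1)) has_real_derivative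
      partial i \<phi> (x + s *\<^sub>R axis i 1)) (at 0)"
    by (simp add: algebra_simps)
  then show ?thesis
    using DERIV_shift[of "\<lambda>s. \<phi> (x + s *\<^sub>R axis i 1)" "partial i \<phi> (x + s *\<^sub>R axis i 1)" 0 s]
    by (simp add: add.commute)
qed

lemma partial_eqI:
  "((\<lambda>s. \<phi> (x + s *\<^sub>R axis i 1)) has_real_derivative d) (at 0) \<Longrightarrow> partial i \<phi> x = d"
  unfolding partial_def by (rule DERIV_imp_deriv)

lemma partial_const: "partial i (\<lambda>_. k) = (\<lambda>_. 0)"
  by (rule ext, rule partial_eqI) simp

lemma C2_const: "C2 (\<lambda>_. k)"
  by (simp add: C2_def C1_def partial_const)

lemma partial_lincomb:
  assumes "C1 \<phi>" "C1 \<psi>"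
  shows "partial i (\<lambda>x. a * \<phi> x + b * \<psi> x) = (\<lambda>x. a * partial i \<phi> x + b * partial i \<psi> x)"
proof
  fix x
  show "partial i (\<lambda>x. a * \<phi> x + b * \<psi> x) x = a * partial i \<phi> x + b * partial i \<psi> x"
    using C1_has_partial[OF assms(1), of x i 0] C1_has_partial[OF assms(2), of x i 0]
    by (intro partial_eqI) (auto intro!: derivative_eq_intros)
qed

lemma C1_lincomb:
  assumes "C1 \<phi>" "C1 \<psi>"
  shows "C1 (\<lambda>x. a * \<phi> x + b * \<psi> x)"
  unfolding C1_def partial_lincomb[OF assms]
  using assms by (auto simp: C1_def intro!: continuous_intros derivative_intros)

lemma C2_lincomb:
  assumes "C2 \<phi>" "C2 \<psi>"
  shows "C2 (\<lambda>x. a * \<phi> x + b * \<psi> x)"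
  using assms by (auto simp: C2_def partial_lincomb intro!: C1_lincomb)

lemma laplacian_lincomb:
  assumes "C2 \<phi>" "C2 \<psi>"
  shows "laplacian (\<lambda>x. a * \<phi> x + b * \<psi> x) y = a * laplacian \<phi> y + b * laplacian \<psi> y"
  using assms unfolding laplacian_def
  by (simp add: C2_def partial_lincomb sum.distrib sum_distrib_left)

lemma grad_lincomb:
  assumes "C1 \<phi>" "C1 \<psi>"
  shows "grad (\<lambda>x. a * \<phi> x + b * \<psi> x) y = a *\<^sub>R grad \<phi> y + b *\<^sub>R grad \<psi> y"
  by (simp add: grad_def partial_lincomb[OF assms] vec_eq_iff)

section \<open>A one-dimensional barrier\<close>

definition barrier :: "nat \<Rightarrow> real \<Rightarrow> real" where
  "barrier n s = (1 / (1 - s\<^sup>2)) ^ n"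

definition barrier' :: "nat \<Rightarrow> real \<Rightarrow> real" where
  "barrier' n s = 2 * real n * s * (1 / (1 - s\<^sup>2)) ^ Suc n"

definition barrier'' :: "nat \<Rightarrow> real \<Rightarrow> real" where
  "barrier'' n s =
     2 * real n * (1 / (1 - s\<^sup>2)) ^ Suc n + 4 * real n * real (Suc n) * s\<^sup>2 * (1 / (1 - s\<^sup>2)) ^ (n + 2)"

lemma one_minus_square_pos: "\<bar>s\<bar> < 1 \<Longrightarrow> 0 < 1 - (s::real)\<^sup>2"
  by (simp add: abs_square_less_1)

lemma DERIV_inverse_one_minus_square:
  assumes "\<bar>s\<bar> < (1::real)"
  shows "((\<lambda>s. 1 / (1 - s\<^sup>2)) has_real_derivative 2 * s * (1 / (1 - s\<^sup>2))\<^sup>2) (at s)"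
  using one_minus_square_pos[OF assms]
  by (auto intro!: derivative_eq_intros simp: power2_eq_square)

lemma DERIV_barrier:
  assumes "\<bar>s\<bar> < 1"
  shows "(barrier n has_real_derivative barrier' n s) (at s)"
proof (cases n)
  case 0
  then show ?thesis by (simp add: barrier_def[abs_def] barrier'_def)
next
  case (Suc k)
  show ?thesis
    unfolding barrier_def[abs_def] barrier'_def
    by (rule DERIV_cong[OF DERIV_power[OF DERIV_inverse_one_minus_square[OF assms]]])
       (simp add: Suc power2_eq_square field_simps)
qed

lemma DERIV_barrier':
  assumes "\<bar>s\<bar> < 1"
  shows "(barrier' n has_real_derivative barrier'' n s) (at s)"
proof -
  let ?v = "\<lambda>s::real. 1 / (1 - s\<^sup>2)"
  have 1: "((\<lambda>s. ?v s ^ Suc n) has_real_derivative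
      real (Suc n) * (2 * s * (?v s)\<^sup>2 * ?v s ^ n)) (at s)"
    by (rule DERIV_cong[OF DERIV_power[OF DERIV_inverse_one_minus_square[OF assms]]]) simp
  have 2: "((\<lambda>s. 2 * real n * s) has_real_derivative 2 * real n) (at s)"
    by (auto intro!: derivative_eq_intros)
  show ?thesis
    unfolding barrier'_def[abs_def] barrier''_def
    by (rule DERIV_cong[OF DERIV_mult[OF 2 1]])
       (simp add: power2_eq_square power_add ac_simps)
qed

lemma barrier_ge_1:
  assumes "\<bar>s\<bar> < 1"
  shows "1 \<le> barrier n s"
  using one_minus_square_pos[OF assms] by (simp add: barrier_def one_le_power)

lemma barrier_0: "barrier n 0 = 1"
  by (simp add: barrier_def)

text \<open>The comparison takes place on a compact cube inside the open one, whose faces are the sets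
  \<open>\<bar>x\<^sub>i\<bar> = r\<close>; there the barrier has to exceed a bound \<open>B\<close> that depends on the subsolution.\<close>
lemma barrier_blows_up:
  assumes "n \<ge> 1"
  obtains r where "0 < r" "r < 1" "\<And>s. \<bar>s\<bar> = r \<Longrightarrow> B < barrier n s"
proof
  define b where "b = max 1 B + 1"
  define r where "r = sqrt (1 - 1 / b)"
  have b: "b > 1" "b > B" by (auto simp: b_def)
  show "0 < r" "r < 1" using b by (auto simp: r_def)
  fix s assume "\<bar>s\<bar> = r"
  then have "s\<^sup>2 = r\<^sup>2" by (metis power2_abs)
  also have "r\<^sup>2 = 1 - 1 / b" using b by (simp add: r_def)
  finally have "barrier n s = b ^ n" by (simp add: barrier_def)
  moreover have "b \<le> b ^ n" using b assms by (metis less_imp_le one_le_numeral power_increasing power_one_right)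
  ultimately show "B < barrier n s" using b by linarith
qed

text \<open>In terms of \<open>v = 1 / (1 - s\<^sup>2) \<ge> 1\<close> the left-hand side is at most \<open>C v\<^bsup>n+2\<^esup>\<close>. For large
  \<open>v\<close> also \<open>\<bar>s\<bar> \<ge> 1/2\<close>, and \<open>\<bar>g'\<bar>\<^sup>\<theta> \<ge> v\<^bsup>(n+1)\<theta>\<^esup> \<ge> v\<^bsup>n+3\<^esup>\<close>, which exceeds
  any multiple of \<open>v\<^bsup>n+2\<^esup>\<close>; for bounded \<open>v\<close> the constant \<open>A\<close> does the work. The
  choice \<open>n (\<theta> - 1) \<ge> 2\<close> gains the one extra power of \<open>v\<close>.\<close>
lemma barrier_supersolution:
  assumes "\<theta> > 1" "n \<ge> 1" "real n * (\<theta> - 1) \<ge> 2" "c > 0"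
  obtains A where "\<And>s. \<bar>s\<bar> < 1 \<Longrightarrow> barrier'' n s / 2 \<le> c * \<bar>barrier' n s\<bar> powr \<theta> + A"
proof -
  define C where "C = 2 * real n + 4 * real n * real (Suc n)"
  define R where "R = max 2 (C / c)"
  have C: "C \<ge> 0" by (simp add: C_def)
  have "barrier'' n s / 2 \<le> c * \<bar>barrier' n s\<bar> powr \<theta> + C * R ^ (n + 2)" if s: "\<bar>s\<bar> < 1" for s
  proof -
    define v where "v = 1 / (1 - s\<^sup>2)"
    note pos = one_minus_square_pos[OF s]
    have v: "v \<ge> 1" using pos by (simp add: v_def)
    have "s\<^sup>2 \<le> 1" using pos by simp
    then have "4 * real n * real (Suc n) * s\<^sup>2 * v ^ (n + 2) \<le> 4 * real n * real (Suc n) * 1 * v ^ (n + 2)"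
      using v by (intro mult_right_mono mult_left_mono) auto
    moreover have "2 * real n * v ^ Suc n \<le> 2 * real n * v ^ (n + 2)"
      using v by (intro mult_left_mono power_increasing) auto
    ultimately have "barrier'' n s \<le> C * v ^ (n + 2)"
      unfolding barrier''_def C_def v_def[symmetric] by (simp add: algebra_simps)
    moreover have "0 \<le> C * v ^ (n + 2)" using C v by simp
    ultimately have up: "barrier'' n s / 2 \<le> C * v ^ (n + 2)" by linarith
    show ?thesis
    proof (cases "v \<le> R")
      case True
      then have "C * v ^ (n + 2) \<le> C * R ^ (n + 2)"
        using C v by (intro mult_left_mono power_mono) auto
      moreover have "0 \<le> c * \<bar>barrier' n s\<bar> powr \<theta>" using assms by simp
      ultimately show ?thesis using up by linarith
    next
      case False
      then have v2: "v \<ge> 2" "C / c \<le> v" by (auto simp: R_def)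
      have "1 / v = 1 - s\<^sup>2" by (simp add: v_def)
      moreover have "1 / v \<le> 1 / 2" using v2 by (intro divide_left_mono) auto
      ultimately have "(1/2)\<^sup>2 \<le> \<bar>s\<bar>\<^sup>2" by (simp add: power2_eq_square)
      then have "1/2 \<le> \<bar>s\<bar>" by (rule power2_le_imp_le) simp
      then have "1 * (1/2) \<le> real n * \<bar>s\<bar>" using assms by (intro mult_mono) auto
      then have "1 * v ^ Suc n \<le> (2 * real n * \<bar>s\<bar>) * v ^ Suc n"
        using v by (intro mult_right_mono) auto
      also have "\<dots> = \<bar>barrier' n s\<bar>"
        using v unfolding barrier'_def v_def[symmetric] by (simp add: abs_mult)
      finally have "(v ^ Suc n) powr \<theta> \<le> \<bar>barrier' n s\<bar> powr \<theta>"
        using v assms by (intro powr_mono2) auto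
      moreover have "(v ^ Suc n) powr \<theta> = v powr (real (Suc n) * \<theta>)"
        using v by (simp only: powr_realpow[symmetric] powr_powr)
      moreover have "v powr real (n + 3) \<le> v powr (real (Suc n) * \<theta>)"
        using v assms by (intro powr_mono) (auto simp: algebra_simps)
      moreover have "v powr real (n + 3) = v * v ^ (n + 2)"
        using v by (subst powr_realpow) (auto simp: power_add eval_nat_numeral)
      ultimately have "v * v ^ (n + 2) \<le> \<bar>barrier' n s\<bar> powr \<theta>" by linarith
      moreover have "C / c * v ^ (n + 2) \<le> v * v ^ (n + 2)"
        using v v2 by (intro mult_right_mono) auto
      ultimately have "C / c * v ^ (n + 2) \<le> \<bar>barrier' n s\<bar> powr \<theta>" by linarith
      then have "C * v ^ (n + 2) \<le> c * \<bar>barrier' n s\<bar> powr \<theta>"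
        using assms by (simp add: field_simps)
      moreover have "0 \<le> C * R ^ (n + 2)" using C by (simp add: R_def)
      ultimately show ?thesis using up by linarith
    qed
  qed
  then show ?thesis by (rule that)
qed

section \<open>Comparison on a cube\<close>

lemma second_derivative_nonpos_at_local_max:
  fixes \<psi> :: "real \<Rightarrow> real"
  assumes "d > 0"
    and D: "\<And>s. \<bar>s - x\<bar> < d \<Longrightarrow> (\<psi> has_real_derivative \<psi>' s) (at s)"
    and D2: "(\<psi>' has_real_derivative k) (at x)"
    and max: "\<And>s. \<bar>s - x\<bar> < d \<Longrightarrow> \<psi> s \<le> \<psi> x"
  shows "\<psi>' x = 0" and "k \<le> 0"
proof -
  show 0: "\<psi>' x = 0"
    by (rule DERIV_local_max[OF D[of x] \<open>d > 0\<close>]) (use max \<open>d > 0\<close> in \<open>auto simp: abs_minus_commute\<close>)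
  show "k \<le> 0"
  proof (rule ccontr)
    assume "\<not> k \<le> 0"
    \<comment> \<open>Then the derivative is positive just to the right of \<open>x\<close>, and \<open>\<psi>\<close> increases there.\<close>
    then obtain e where e: "e > 0" "\<And>h. 0 < h \<Longrightarrow> h < e \<Longrightarrow> \<psi>' x < \<psi>' (x + h)"
      using DERIV_pos_inc_right[OF D2] by auto
    define h where "h = min d e / 2"
    have h: "0 < h" "h < d" "h < e" using e \<open>d > 0\<close> by (auto simp: h_def)
    obtain z where z: "x < z" "z < x + h" "\<psi> (x + h) - \<psi> x = (x + h - x) * \<psi>' z"
      using MVT2[of x "x + h" \<psi> \<psi>'] D h by force
    have "\<psi>' z > 0" using e(2)[of "z - x"] z h 0 by simp
    then have "0 < (x + h - x) * \<psi>' z" using h by simp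
    then have "\<psi> (x + h) > \<psi> x" using z by linarith
    then show False using max[of "x + h"] h by simp
  qed
qed

lemma continuous_on_locally_lipschitz:
  assumes "locally_lipschitz f"
  shows "continuous_on UNIV f"
proof (rule continuous_at_imp_continuous_on, rule ballI)
  fix x
  obtain r L where "r > 0" "L-lipschitz_on (cball x r) f"
    using assms unfolding locally_lipschitz_def by blast
  then have "continuous_on (cball x r) f" using lipschitz_on_continuous_on by blast
  then have "continuous_on (ball x r) f" by (rule continuous_on_subset) auto
  then show "isCont f x" using \<open>r > 0\<close> by (simp add: continuous_on_eq_continuous_at)
qed

lemma sum_abs_component_powr_le:
  fixes p :: "real^'m"
  assumes "\<theta> \<ge> 0"
  shows "(\<Sum>i\<in>UNIV. \<bar>p $ i\<bar> powr \<theta>) \<le> real CARD('m) * norm p powr \<theta>"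
proof -
  have "(\<Sum>i\<in>UNIV. \<bar>p $ i\<bar> powr \<theta>) \<le> (\<Sum>i\<in>(UNIV::'m set). norm p powr \<theta>)"
    using assms by (intro sum_mono powr_mono2) (auto intro: component_le_norm_cart)
  then show ?thesis by simp
qed

text \<open>The maximum of \<open>\<phi> - w\<close> over a slightly smaller closed cube is interior: the value at the
  origin is at least \<open>-P - m\<close>, where \<open>P\<close> bounds \<open>\<bar>\<phi>\<bar>\<close> and \<open>m\<close> is the dimension, and on
  the faces \<open>\<phi> - w\<close> is smaller than that. The two conclusions are the first- and second-order
  conditions along the coordinate directions.\<close>
lemma C2_touched_by_barrier:
  fixes \<phi> :: "real^'m \<Rightarrow> real"
  assumes "C2 \<phi>" "n \<ge> 1"
  obtains x where "\<And>i. \<bar>x $ i\<bar> < 1"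
    "\<And>i. partial i \<phi> x = barrier' n (x $ i)"
    "\<And>i. partial i (partial i \<phi>) x \<le> barrier'' n (x $ i)"
proof -
  define w where "w x = (\<Sum>i\<in>UNIV. barrier n (x $ i))" for x :: "real^'m"
  have C1: "C1 \<phi>" "C1 (partial i \<phi>)" for i using assms by (auto simp: C2_def)
  have contphi: "continuous_on S \<phi>" for S
    using C1(1) differentiable_imp_continuous_on continuous_on_subset[of UNIV \<phi> S]
    by (auto simp: C1_def)
  have "bounded (\<phi> ` cbox (-1) 1)"
    by (intro compact_imp_bounded compact_continuous_image contphi compact_cbox)
  then obtain P where P: "\<And>x. x \<in> cbox (-1) 1 \<Longrightarrow> \<bar>\<phi> x\<bar> \<le> P"
    by (auto simp: bounded_iff)
  obtain r where r: "0 < r" "r < 1"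
    and big: "\<And>s. \<bar>s\<bar> = r \<Longrightarrow> 2 * P + real CARD('m) < barrier n s"
    using barrier_blows_up[OF \<open>n \<ge> 1\<close>] by blast
  define K where "K = cbox (- (\<chi> i. r)) (\<chi> i. r :: real^'m)"
  have K: "x \<in> K \<longleftrightarrow> (\<forall>i. \<bar>x $ i\<bar> \<le> r)" for x :: "real^'m"
    by (auto simp: K_def mem_box_cart abs_le_iff minus_le_iff)
  have K1: "\<bar>x $ i\<bar> < 1" if "x \<in> K" for x i
    using that r by (auto simp: K intro: le_less_trans)
  have KQ: "x \<in> cbox (-1) 1" if "x \<in> K" for x
    using K1[OF that] by (auto simp: mem_box_cart abs_less_iff minus_less_iff less_imp_le)
  have contb: "continuous_on {-r..r} (barrier n)"
    using r DERIV_barrier by (intro DERIV_atLeastAtMost_imp_continuous_on) force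
  have "continuous_on K (\<lambda>x. barrier n (x $ i))" for i
    by (rule continuous_on_compose2[OF contb])
       (auto intro!: continuous_intros simp: K abs_le_iff minus_le_iff)
  then have "continuous_on K (\<lambda>x. \<phi> x - w x)"
    unfolding w_def by (intro continuous_intros contphi)
  moreover have "compact K" "0 \<in> K" using r by (simp add: K_def compact_cbox) (simp add: K less_imp_le r)
  ultimately obtain x where x: "x \<in> K" and max: "\<And>y. y \<in> K \<Longrightarrow> \<phi> y - w y \<le> \<phi> x - w x"
    using continuous_attains_sup[of K "\<lambda>x. \<phi> x - w x"] by blast
  have int: "\<bar>x $ i\<bar> < r" for i
  proof (rule ccontr)
    assume "\<not> \<bar>x $ i\<bar> < r"
    then have "\<bar>x $ i\<bar> = r" using x by (auto simp: K intro: antisym)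
    then have "2 * P + real CARD('m) < barrier n (x $ i)" by (rule big)
    also have "\<dots> \<le> w x"
      unfolding w_def using K1[OF x] barrier_ge_1
      by (intro member_le_sum) (auto intro: order_trans[OF zero_le_one])
    finally have "2 * P + real CARD('m) < w x" .
    moreover have "w 0 = real CARD('m)" by (simp add: w_def barrier_0)
    moreover have "\<phi> 0 - w 0 \<le> \<phi> x - w x" using max \<open>0 \<in> K\<close> by blast
    moreover have "\<bar>\<phi> 0\<bar> \<le> P" "\<bar>\<phi> x\<bar> \<le> P" using P KQ x \<open>0 \<in> K\<close> by auto
    ultimately show False by linarith
  qed
  have crit: "partial i \<phi> x - barrier' n (x $ i) = 0 \<and>
      partial i (partial i \<phi>) x - barrier'' n (x $ i) \<le> 0" for i
  proof -
    define \<psi> where "\<psi> s = \<phi> (x + s *\<^sub>R axis i 1) - barrier n (x $ i + s)" for s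
    define \<psi>' where "\<psi>' s = partial i \<phi> (x + s *\<^sub>R axis i 1) - barrier' n (x $ i + s)" for s
    define d where "d = r - \<bar>x $ i\<bar>"
    have d: "d > 0" using int by (simp add: d_def)
    have sm: "\<bar>x $ i + s\<bar> < 1" if "\<bar>s\<bar> < d" for s using that r by (simp add: d_def)
    have D: "(\<psi> has_real_derivative \<psi>' s) (at s)" if "\<bar>s - 0\<bar> < d" for s
    proof -
      have "((\<lambda>s. barrier n (x $ i + s)) has_real_derivative barrier' n (x $ i + s)) (at s)"
        using DERIV_barrier[OF sm] that by (simp add: DERIV_shift add.commute)
      then show ?thesis unfolding \<psi>_def[abs_def] \<psi>'_def
        by (intro DERIV_diff C1_has_partial C1)
    qed
    have D2: "(\<psi>' has_real_derivative partial i (partial i \<phi>) x - barrier'' n (x $ i)) (at 0)"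
    proof -
      have "((\<lambda>s. barrier' n (x $ i + s)) has_real_derivative barrier'' n (x $ i)) (at 0)"
        using DERIV_barrier'[OF sm[of 0], of n] d DERIV_shift[of "barrier' n" _ 0 "x $ i"]
        by (simp add: add.commute)
      moreover have "((\<lambda>s. partial i \<phi> (x + s *\<^sub>R axis i 1)) has_real_derivative
          partial i (partial i \<phi>) x) (at 0)"
        using C1_has_partial[OF C1(2)[of i], of x i 0] by simp
      ultimately show ?thesis unfolding \<psi>'_def[abs_def] by (intro DERIV_diff)
    qed
    have M: "\<psi> s \<le> \<psi> 0" if "\<bar>s - 0\<bar> < d" for s
    proof -
      have "x + s *\<^sub>R axis i 1 \<in> K"
        using int that by (auto simp: K axis_def d_def less_imp_le)
      then have "\<phi> (x + s *\<^sub>R axis i 1) - w (x + s *\<^sub>R axis i 1) \<le> \<phi> x - w x" by (rule max)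
      moreover have "w (x + s *\<^sub>R axis i 1) - w x = barrier n (x $ i + s) - barrier n (x $ i)"
      proof -
        have "w z = barrier n (z $ i) + (\<Sum>j\<in>UNIV - {i}. barrier n (z $ j))" for z
          unfolding w_def by (simp add: sum.remove)
        moreover have "(\<Sum>j\<in>UNIV - {i}. barrier n ((x + s *\<^sub>R axis i 1) $ j))
            = (\<Sum>j\<in>UNIV - {i}. barrier n (x $ j))"
          by (intro sum.cong) (auto simp: axis_def)
        ultimately show ?thesis by (simp add: axis_def)
      qed
      ultimately show ?thesis by (simp add: \<psi>_def)
    qed
    have "\<psi>' 0 = 0" "partial i (partial i \<phi>) x - barrier'' n (x $ i) \<le> 0"
      using second_derivative_nonpos_at_local_max[OF d D D2 M] by auto
    then show ?thesis by (simp add: \<psi>'_def)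
  qed
  show ?thesis by (rule that[of x]) (use K1[OF x] crit in \<open>auto simp: algebra_simps\<close>)
qed

section \<open>The set of admissible constants\<close>

definition subsolution :: "real \<Rightarrow> (real^'m \<Rightarrow> real) \<Rightarrow> real \<Rightarrow> (real^'m \<Rightarrow> real) \<Rightarrow> bool" where
  "subsolution \<theta> f l \<phi> \<longleftrightarrow> C2 \<phi> \<and>
     (\<forall>y. - (1/2) * laplacian \<phi> y + (1/\<theta>) * norm (grad \<phi> y) powr \<theta> \<le> f y - l)"

definition admissible :: "real \<Rightarrow> (real^'m \<Rightarrow> real) \<Rightarrow> real set" where
  "admissible \<theta> f = {l. \<exists>\<phi>. subsolution \<theta> f l \<phi>}"

lemma critical_value_eq_Sup_admissible: "critical_value \<theta> f = Sup (admissible \<theta> f)"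
  by (simp add: critical_value_def admissible_def subsolution_def)

lemma admissible_nonempty:
  fixes f :: "real^'m \<Rightarrow> real"
  assumes "bdd_below (range f)"
  shows "admissible \<theta> f \<noteq> {}"
proof -
  obtain b where "\<And>y. b \<le> f y" using assms by (auto simp: bdd_below_def)
  then have "subsolution \<theta> f b (\<lambda>_. 0)"
    by (simp add: subsolution_def C2_const laplacian_def grad_def partial_const
        zero_vec_def[symmetric])
  then show ?thesis by (auto simp: admissible_def)
qed

text \<open>At the point where the subsolution is touched by the barrier, summing the one-dimensional
  inequalities bounds \<open>\<Delta>\<phi> / 2\<close> by \<open>\<bar>D\<phi>\<bar>\<^sup>\<theta> / \<theta>\<close> plus a constant. The factor
  \<open>1 / (\<theta> m)\<close>, with \<open>m\<close> the dimension, compensates for replacing \<open>\<Sum>i. \<bar>\<partial>\<^sub>i\<phi>\<bar>\<^sup>\<theta>\<close> by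
  \<open>m \<bar>D\<phi>\<bar>\<^sup>\<theta>\<close>.\<close>
lemma admissible_bdd_above:
  fixes f :: "real^'m \<Rightarrow> real"
  assumes "\<theta> > 1" and cont: "continuous_on UNIV f"
  shows "bdd_above (admissible \<theta> f)"
proof -
  define m where "m = real CARD('m)"
  have m: "m > 0" by (simp add: m_def)
  obtain n :: nat where "2 / (\<theta> - 1) \<le> real n" using real_arch_simple by blast
  then have n: "real n * (\<theta> - 1) \<ge> 2" using \<open>\<theta> > 1\<close> by (simp add: field_simps)
  then have n1: "n \<ge> 1" by (cases n) auto
  have "1 / (\<theta> * m) > 0" using \<open>\<theta> > 1\<close> m by simp
  then obtain A where A:
    "\<And>s. \<bar>s\<bar> < 1 \<Longrightarrow> barrier'' n s / 2 \<le> 1 / (\<theta> * m) * \<bar>barrier' n s\<bar> powr \<theta> + A"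
    using barrier_supersolution[OF \<open>\<theta> > 1\<close> n1 n] by blast
  have "bounded (f ` cbox (-1) 1)"
    by (intro compact_imp_bounded compact_continuous_image compact_cbox
        continuous_on_subset[OF cont]) auto
  then obtain M where M: "\<And>x. x \<in> cbox (-1) 1 \<Longrightarrow> \<bar>f x\<bar> \<le> M"
    by (auto simp: bounded_iff)
  have "l \<le> M + m * A" if "subsolution \<theta> f l \<phi>" for l \<phi>
  proof -
    have C2: "C2 \<phi>" and sub: "\<And>y. - (1/2) * laplacian \<phi> y + (1/\<theta>) * norm (grad \<phi> y) powr \<theta> \<le> f y - l"
      using that by (auto simp: subsolution_def)
    obtain x where x: "\<And>i. \<bar>x $ i\<bar> < 1" "\<And>i. partial i \<phi> x = barrier' n (x $ i)"
      "\<And>i. partial i (partial i \<phi>) x \<le> barrier'' n (x $ i)"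
      using C2_touched_by_barrier[OF C2 n1] by blast
    have "laplacian \<phi> x / 2 = (\<Sum>i\<in>UNIV. partial i (partial i \<phi>) x / 2)"
      by (simp add: laplacian_def sum_divide_distrib)
    also have "\<dots> \<le> (\<Sum>i\<in>UNIV. 1 / (\<theta> * m) * \<bar>grad \<phi> x $ i\<bar> powr \<theta> + A)"
    proof (rule sum_mono)
      fix i
      show "partial i (partial i \<phi>) x / 2 \<le> 1 / (\<theta> * m) * \<bar>grad \<phi> x $ i\<bar> powr \<theta> + A"
        using A[OF x(1)[of i]] x(3)[of i] by (simp add: grad_def x(2))
    qed
    also have "\<dots> = 1 / (\<theta> * m) * (\<Sum>i\<in>UNIV. \<bar>grad \<phi> x $ i\<bar> powr \<theta>) + m * A"
      by (simp add: sum.distrib sum_distrib_left m_def)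
    also have "\<dots> \<le> 1 / (\<theta> * m) * (m * norm (grad \<phi> x) powr \<theta>) + m * A"
      using sum_abs_component_powr_le[of \<theta> "grad \<phi> x"] \<open>\<theta> > 1\<close> m
      by (intro add_right_mono mult_left_mono) (auto simp: m_def)
    also have "\<dots> = (1/\<theta>) * norm (grad \<phi> x) powr \<theta> + m * A"
      using m by simp
    finally have "laplacian \<phi> x / 2 \<le> (1/\<theta>) * norm (grad \<phi> x) powr \<theta> + m * A" .
    moreover have "x \<in> cbox (-1) 1"
      using x(1) by (auto simp: mem_box_cart abs_less_iff minus_less_iff less_imp_le)
    then have "f x \<le> M" using M by fastforce
    ultimately show ?thesis using sub[of x] by linarith
  qed
  then show ?thesis by (auto simp: bdd_above_def admissible_def)
qed

lemma admissible_add_const: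
  assumes "l \<in> admissible \<theta> f"
  shows "l + c \<in> admissible \<theta> (\<lambda>y. f y + c)"
  using assms by (auto simp: admissible_def subsolution_def)

lemma admissible_mono:
  assumes "\<And>y. f y \<le> g y"
  shows "admissible \<theta> f \<subseteq> admissible \<theta> g"
proof -
  have "subsolution \<theta> f l \<phi> \<Longrightarrow> subsolution \<theta> g l \<phi>" for l \<phi>
    unfolding subsolution_def by (meson assms diff_right_mono order_trans)
  then show ?thesis by (auto simp: admissible_def)
qed

text \<open>On the open half-line this is convexity of \<open>x \<mapsto> x powr \<theta>\<close>; if one of the points is
  \<open>0\<close> it reduces to \<open>t powr \<theta> \<le> t\<close>.\<close>
lemma powr_convex_comb_le:
  fixes x y :: real
  assumes "\<theta> \<ge> 1" "0 \<le> t" "t \<le> 1" "0 \<le> x" "0 \<le> y"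
  shows "(t * x + (1 - t) * y) powr \<theta> \<le> t * x powr \<theta> + (1 - t) * y powr \<theta>"
proof -
  have scale: "(u * z) powr \<theta> \<le> u * z powr \<theta>" if "0 \<le> u" "u \<le> 1" "0 \<le> z" for u z :: real
  proof -
    have "u powr \<theta> \<le> u"
      using powr_mono'[of 1 \<theta> u] assms(1) that by simp
    then show ?thesis using that by (simp add: powr_mult mult_right_mono)
  qed
  consider "x = 0" | "y = 0" | "0 < x" "0 < y" using assms by linarith
  then show ?thesis
  proof cases
    case 1
    then show ?thesis using scale[of "1 - t" y] assms by simp
  next
    case 2
    then show ?thesis using scale[of t x] assms by simp
  next
    case 3
    then show ?thesis
      using convex_onD[OF powr_convex[OF assms(1)], of "1 - t" x y] assms by simp
  qed
qed

lemma norm_powr_convex: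
  fixes p q :: "'a::real_normed_vector"
  assumes "\<theta> \<ge> 1" "0 \<le> t" "t \<le> 1"
  shows "norm (t *\<^sub>R p + (1 - t) *\<^sub>R q) powr \<theta> \<le> t * norm p powr \<theta> + (1 - t) * norm q powr \<theta>"
proof -
  have "norm (t *\<^sub>R p + (1 - t) *\<^sub>R q) \<le> t * norm p + (1 - t) * norm q"
    using norm_triangle_ineq[of "t *\<^sub>R p" "(1 - t) *\<^sub>R q"] assms by simp
  then have "norm (t *\<^sub>R p + (1 - t) *\<^sub>R q) powr \<theta> \<le> (t * norm p + (1 - t) * norm q) powr \<theta>"
    using assms by (intro powr_mono2) auto
  also have "\<dots> \<le> t * norm p powr \<theta> + (1 - t) * norm q powr \<theta>"
    using assms by (intro powr_convex_comb_le) auto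
  finally show ?thesis .
qed

lemma admissible_convex_comb:
  fixes f\<^sub>1 f\<^sub>2 :: "real^'m \<Rightarrow> real"
  assumes "\<theta> \<ge> 1" "0 \<le> t" "t \<le> 1" "l\<^sub>1 \<in> admissible \<theta> f\<^sub>1" "l\<^sub>2 \<in> admissible \<theta> f\<^sub>2"
  shows "t * l\<^sub>1 + (1 - t) * l\<^sub>2 \<in> admissible \<theta> (\<lambda>y. t * f\<^sub>1 y + (1 - t) * f\<^sub>2 y)"
proof -
  obtain \<phi> \<psi> where \<phi>: "C2 \<phi>"
    "\<And>y. - (1/2) * laplacian \<phi> y + (1/\<theta>) * norm (grad \<phi> y) powr \<theta> \<le> f\<^sub>1 y - l\<^sub>1"
    and \<psi>: "C2 \<psi>"
    "\<And>y. - (1/2) * laplacian \<psi> y + (1/\<theta>) * norm (grad \<psi> y) powr \<theta> \<le> f\<^sub>2 y - l\<^sub>2"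
    using assms by (auto simp: admissible_def subsolution_def)
  define \<omega> where "\<omega> x = t * \<phi> x + (1 - t) * \<psi> x" for x
  have C1: "C1 \<phi>" "C1 \<psi>" using \<phi> \<psi> by (auto simp: C2_def)
  have "- (1/2) * laplacian \<omega> y + (1/\<theta>) * norm (grad \<omega> y) powr \<theta>
      \<le> (t * f\<^sub>1 y + (1 - t) * f\<^sub>2 y) - (t * l\<^sub>1 + (1 - t) * l\<^sub>2)" for y
  proof -
    have "(1/\<theta>) * norm (grad \<omega> y) powr \<theta>
        \<le> (1/\<theta>) * (t * norm (grad \<phi> y) powr \<theta> + (1 - t) * norm (grad \<psi> y) powr \<theta>)"
      unfolding \<omega>_def[abs_def] grad_lincomb[OF C1]
      using assms by (intro mult_left_mono norm_powr_convex) auto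
    moreover have "t * (- (1/2) * laplacian \<phi> y + (1/\<theta>) * norm (grad \<phi> y) powr \<theta>)
        \<le> t * (f\<^sub>1 y - l\<^sub>1)"
      using \<phi>(2) assms by (intro mult_left_mono) auto
    moreover have "(1 - t) * (- (1/2) * laplacian \<psi> y + (1/\<theta>) * norm (grad \<psi> y) powr \<theta>)
        \<le> (1 - t) * (f\<^sub>2 y - l\<^sub>2)"
      using \<psi>(2) assms by (intro mult_left_mono) auto
    moreover have "laplacian \<omega> y = t * laplacian \<phi> y + (1 - t) * laplacian \<psi> y"
      unfolding \<omega>_def[abs_def] by (rule laplacian_lincomb[OF \<phi>(1) \<psi>(1)])
    ultimately show ?thesis
      by (simp add: algebra_simps add_divide_distrib diff_divide_distrib)
  qed
  moreover have "C2 \<omega>" unfolding \<omega>_def[abs_def] by (rule C2_lincomb[OF \<phi>(1) \<psi>(1)])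
  ultimately show ?thesis by (auto simp: admissible_def subsolution_def)
qed

section \<open>Properties of the critical value\<close>

lemma critical_value_add_const_ge:
  fixes f :: "real^'m \<Rightarrow> real"
  assumes "\<theta> > 1" "continuous_on UNIV f" "bdd_below (range f)"
  shows "critical_value \<theta> f + c \<le> critical_value \<theta> (\<lambda>y. f y + c)"
proof -
  have "bdd_above (admissible \<theta> (\<lambda>y. f y + c))"
    using assms by (intro admissible_bdd_above continuous_intros)
  then have "l + c \<le> Sup (admissible \<theta> (\<lambda>y. f y + c))" if "l \<in> admissible \<theta> f" for l
    using that by (intro cSup_upper admissible_add_const)
  then have "Sup (admissible \<theta> f) \<le> Sup (admissible \<theta> (\<lambda>y. f y + c)) - c"
    by (intro cSup_least admissible_nonempty assms) (simp add: le_diff_eq)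
  then show ?thesis by (simp add: critical_value_eq_Sup_admissible)
qed

text \<open>Equality follows from the inequality by applying it once more with \<open>-c\<close>.\<close>
lemma critical_value_add_const:
  fixes f :: "real^'m \<Rightarrow> real"
  assumes "\<theta> > 1" "continuous_on UNIV f" "bdd_below (range f)"
  shows "critical_value \<theta> (\<lambda>y. f y + c) = critical_value \<theta> f + c"
proof (rule antisym)
  obtain b where b: "\<And>y. b \<le> f y" using assms by (auto simp: bdd_below_def)
  have "bdd_below (range (\<lambda>y. f y + c))"
    by (rule bdd_belowI[of _ "b + c"]) (use b in auto)
  then have "critical_value \<theta> (\<lambda>y. f y + c) + (- c) \<le> critical_value \<theta> (\<lambda>y. (f y + c) + (- c))"
    using assms by (intro critical_value_add_const_ge continuous_intros)
  then show "critical_value \<theta> (\<lambda>y. f y + c) \<le> critical_value \<theta> f + c" by simp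
qed (rule critical_value_add_const_ge[OF assms])

lemma critical_value_mono:
  fixes f g :: "real^'m \<Rightarrow> real"
  assumes "\<theta> > 1" "bdd_below (range f)" "continuous_on UNIV g" "\<And>y. f y \<le> g y"
  shows "critical_value \<theta> f \<le> critical_value \<theta> g"
  unfolding critical_value_eq_Sup_admissible
  using assms by (intro cSup_subset_mono admissible_nonempty admissible_bdd_above admissible_mono)

lemma Sup_lincomb_le:
  fixes X Y :: "real set"
  assumes "X \<noteq> {}" "Y \<noteq> {}" "0 \<le> a" "0 \<le> b"
    and le: "\<And>x y. x \<in> X \<Longrightarrow> y \<in> Y \<Longrightarrow> a * x + b * y \<le> u"
  shows "a * Sup X + b * Sup Y \<le> u"
proof -
  have scale: "c * Sup S \<le> v" if "S \<noteq> {}" "0 \<le> c" "\<And>s. s \<in> S \<Longrightarrow> c * s \<le> v" for c v and S :: "real set"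
  proof (cases "c = 0")
    case True
    then show ?thesis using that by auto
  next
    case False
    then have "Sup S \<le> v / c" using that by (intro cSup_least) (auto simp: field_simps)
    then show ?thesis using False that by (simp add: field_simps)
  qed
  have "b * Sup Y \<le> u - a * x" if "x \<in> X" for x
    using le[OF that] assms by (intro scale) (auto simp: algebra_simps)
  then have "a * Sup X \<le> u - b * Sup Y"
    using assms by (intro scale) (auto simp: algebra_simps)
  then show ?thesis by simp
qed

lemma critical_value_concave:
  fixes f\<^sub>1 f\<^sub>2 :: "real^'m \<Rightarrow> real"
  assumes "\<theta> > 1" "continuous_on UNIV f\<^sub>1" "bdd_below (range f\<^sub>1)"
    "continuous_on UNIV f\<^sub>2" "bdd_below (range f\<^sub>2)" "0 \<le> t" "t \<le> 1"
  shows "t * critical_value \<theta> f\<^sub>1 + (1 - t) * critical_value \<theta> f\<^sub>2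
    \<le> critical_value \<theta> (\<lambda>y. t * f\<^sub>1 y + (1 - t) * f\<^sub>2 y)"
proof -
  have "bdd_above (admissible \<theta> (\<lambda>y. t * f\<^sub>1 y + (1 - t) * f\<^sub>2 y))"
    using assms by (intro admissible_bdd_above continuous_intros)
  then show ?thesis
    unfolding critical_value_eq_Sup_admissible using assms
    by (intro Sup_lincomb_le admissible_nonempty cSup_upper admissible_convex_comb) auto
qed

theorem proposition2p5:
  fixes \<theta> :: real
  assumes "\<theta> > 1"
  shows
    "(\<forall>(f :: real^'m \<Rightarrow> real) c.
        locally_lipschitz f \<and> bdd_below (range f) \<longrightarrow>
        critical_value \<theta> (\<lambda>y. f y + c) = critical_value \<theta> f + c) \<and>
     (\<forall>f\<^sub>1 f\<^sub>2 :: real^'m \<Rightarrow> real.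
        locally_lipschitz f\<^sub>1 \<and> bdd_below (range f\<^sub>1) \<and>
        locally_lipschitz f\<^sub>2 \<and> bdd_below (range f\<^sub>2) \<and> (\<forall>y. f\<^sub>1 y \<le> f\<^sub>2 y) \<longrightarrow>
        critical_value \<theta> f\<^sub>1 \<le> critical_value \<theta> f\<^sub>2) \<and>
     (\<forall>(f\<^sub>1 :: real^'m \<Rightarrow> real) f\<^sub>2 t.
        locally_lipschitz f\<^sub>1 \<and> bdd_below (range f\<^sub>1) \<and>
        locally_lipschitz f\<^sub>2 \<and> bdd_below (range f\<^sub>2) \<and> 0 \<le> t \<and> t \<le> 1 \<longrightarrow>
        critical_value \<theta> (\<lambda>y. t * f\<^sub>1 y + (1 - t) * f\<^sub>2 y)
          \<ge> t * critical_value \<theta> f\<^sub>1 + (1 - t) * critical_value \<theta> f\<^sub>2)"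
  by (intro conjI allI impI; elim conjE)
     (blast intro: assms continuous_on_locally_lipschitz
        critical_value_add_const[OF assms] critical_value_mono[OF assms]
        critical_value_concave[OF assms])+

end
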